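(* Let $w\in\mathfrak S_n$ and $R\in\mathrm{SBT}(w)$. Then $$\mathrm{inv}(R)=\ell(\mathrm{perm}(R))-\sum_r\mathrm{coinv}(\mathrm{row}_r(R)),$$ where the sum is over the rows $r$ of $R$ and $\mathrm{coinv}(\mathrm{row}_r(R))$ is the number of pairs of entries $i<j$ in row $r$ with $i$ to the left of $j$.
   Context: $\ell(w)$ is the number of pairs $i<j$ with $w_i>w_j$ (and similarly for any permutation). The Rothe diagram $\mathbb D(w)=\{(i,w_j)\mid i<j,\ w_i>w_j\}$, the cell $(i,w_j)$ lying in row $i$ (rows numbered bottom to top) and column $w_j$; it has $\ell(w)$ cells. A standard balanced tableau of shape $\mathbb D(w)$ is a bijective filling of its cells with $\{1,\ldots,\ell(w)\}$ such that for every cell, the number of cells to its right in the same row with larger entry equals the number of cells above it in the same column with smaller entry; $\mathrm{SBT}(w)$ is the set of these. The inversion number $\mathrm{inv}(R)$ is the number of pairs of entries $i<j$ such that $i$ lies in a strictly higher row than $j$ and in a different column from $j$. The permutation $\mathrm{perm}(R)\in\mathfrak S_{\ell(w)}$ is obtained by rearranging the entries within each row of $R$ into decreasing order from left to right, and then taking the reverse row reading word (each row read right to left, rows taken from bottom to top) as a permutation in one-line notation. *)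

theory Defs
  imports "HOL-Combinatorics.Permutations" "HOL-Library.FuncSet"
begin

definition perm_length :: "nat \<Rightarrow> (nat \<Rightarrow> nat) \<Rightarrow> nat" where
  "perm_length n w = card {(i, j). 1 \<le> i \<and> i < j \<and> j \<le> n \<and> w i > w j}"

text \<open>A cell is a pair (row, column); row indices increase from bottom to top and
  column indices from left to right.\<close>

definition rothe :: "nat \<Rightarrow> (nat \<Rightarrow> nat) \<Rightarrow> (nat \<times> nat) set" where
  "rothe n w = {(i, w j) | i j. 1 \<le> i \<and> i < j \<and> j \<le> n \<and> w i > w j}"

definition balanced :: "(nat \<times> nat) set \<Rightarrow> (nat \<times> nat \<Rightarrow> nat) \<Rightarrow> bool" where
  "balanced D R \<longleftrightarrow> (\<forall>(i, c) \<in> D.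
     card {c'. (i, c') \<in> D \<and> c' > c \<and> R (i, c') > R (i, c)} =
     card {i'. (i', c) \<in> D \<and> i' > i \<and> R (i', c) < R (i, c)})"

definition SBT :: "nat \<Rightarrow> (nat \<Rightarrow> nat) \<Rightarrow> (nat \<times> nat \<Rightarrow> nat) set" where
  "SBT n w = {R \<in> extensional (rothe n w).
     bij_betw R (rothe n w) {1..perm_length n w} \<and> balanced (rothe n w) R}"

text \<open>Since the entries of a tableau are distinct, pairs of entries are counted as pairs of cells.\<close>

definition tableau_inv :: "nat \<Rightarrow> (nat \<Rightarrow> nat) \<Rightarrow> (nat \<times> nat \<Rightarrow> nat) \<Rightarrow> nat" where
  "tableau_inv n w R = card {(x, y). x \<in> rothe n w \<and> y \<in> rothe n w \<and>
     R x < R y \<and> fst x > fst y \<and> snd x \<noteq> snd y}"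

text \<open>The entries of row \<open>r\<close>, listed from left to right.\<close>

definition tableau_row :: "nat \<Rightarrow> (nat \<Rightarrow> nat) \<Rightarrow> (nat \<times> nat \<Rightarrow> nat) \<Rightarrow> nat \<Rightarrow> nat list" where
  "tableau_row n w R r = map (\<lambda>c. R (r, c)) (sorted_list_of_set {c. (r, c) \<in> rothe n w})"

definition coinv :: "nat list \<Rightarrow> nat" where
  "coinv xs = card {(a, b). a < b \<and> b < length xs \<and> xs ! a < xs ! b}"

definition decreasing_row :: "nat \<Rightarrow> (nat \<Rightarrow> nat) \<Rightarrow> (nat \<times> nat \<Rightarrow> nat) \<Rightarrow> nat \<Rightarrow> nat list" where
  "decreasing_row n w R r = rev (sort (tableau_row n w R r))"

definition tableau_word :: "nat \<Rightarrow> (nat \<Rightarrow> nat) \<Rightarrow> (nat \<times> nat \<Rightarrow> nat) \<Rightarrow> nat list" where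
  "tableau_word n w R = concat (map (\<lambda>r. rev (decreasing_row n w R r)) [1..<Suc n])"

text \<open>The function on positive integers with the given one-line notation, extended by the
  identity as required by \<open>permutes\<close>.\<close>

definition of_one_line :: "nat list \<Rightarrow> nat \<Rightarrow> nat" where
  "of_one_line xs i = (if 1 \<le> i \<and> i \<le> length xs then xs ! (i - 1) else i)"

definition tableau_perm :: "nat \<Rightarrow> (nat \<Rightarrow> nat) \<Rightarrow> (nat \<times> nat \<Rightarrow> nat) \<Rightarrow> nat \<Rightarrow> nat" where
  "tableau_perm n w R = of_one_line (tableau_word n w R)"

end

theory Submission
  imports Defs
begin

text \<open>
  Every row is increasing in the reading word, so the inversions of \<open>perm(R)\<close> are exactly the
  pairs of cells in which the strictly higher cell has the smaller entry. Those whose two cells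
  lie in different columns are counted by \<open>inv(R)\<close>. Those in a common column are counted,
  cell by cell, by the right-hand side of the balance condition, whose left-hand side counts the
  coinversions of the rows.
\<close>

text \<open>Inversions are counted on lists because the reading word is a concatenation of rows,
  along which a list can be split; the function form \<open>of_one_line\<close> hides that
  structure.\<close>

definition list_inv :: "nat list \<Rightarrow> nat" where
  "list_inv xs = card {(a, b). a < b \<and> b < length xs \<and> xs ! a > xs ! b}"

lemma perm_length_of_one_line:
  "perm_length (length xs) (of_one_line xs) = list_inv xs"
proof -
  \<comment> \<open>List positions start at 0 and one-line positions at 1. On the target side both
    indices are positive, so truncated subtraction really inverts \<open>Suc\<close>.\<close>
  have "bij_betw (map_prod Suc Suc) {(a, b). a < b \<and> b < length xs \<and> xs ! a > xs ! b}
     {(i, j). 1 \<le> i \<and> i < j \<and> j \<le> length xs \<and> of_one_line xs i > of_one_line xs j}"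
    by (rule bij_betw_byWitness[where f' = "map_prod (\<lambda>i. i - 1) (\<lambda>i. i - 1)"])
      (auto simp: of_one_line_def)
  then show ?thesis
    unfolding perm_length_def list_inv_def by (rule bij_betw_same_card[symmetric])
qed

lemma list_inv_sorted: "sorted xs \<Longrightarrow> list_inv xs = 0"
proof -
  assume "sorted xs"
  then have "{(a, b). a < b \<and> b < length xs \<and> xs ! a > xs ! b} = {}"
    by (auto simp: not_less[symmetric] sorted_iff_nth_mono_less)
  then show ?thesis
    unfolding list_inv_def by (simp only: card.empty)
qed

text \<open>An inversion lies inside one of the two lists or crosses between them. A crossing pair
  is in position order automatically, so only its values matter; distinctness lets it be counted by
  values, which later turn into cells.\<close>

lemma list_inv_append:
  assumes "distinct xs" "distinct ys"
  shows "list_inv (xs @ ys) = list_inv xs + list_inv ys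
    + card {(u, v). u \<in> set xs \<and> v \<in> set ys \<and> u > v}"
proof -
  let ?m = "length xs"
  let ?A = "{(a, b). a < b \<and> b < length xs \<and> xs ! a > xs ! b}"
  let ?B = "{(a, b). a < b \<and> b < length ys \<and> ys ! a > ys ! b}"
  let ?C = "{(a, b). a < length xs \<and> b < length ys \<and> xs ! a > ys ! b}"
  let ?D = "{(u, v). u \<in> set xs \<and> v \<in> set ys \<and> u > v}"
  let ?f = "map_prod ((+) ?m) ((+) ?m)" and ?g = "map_prod id ((+) ?m)"
  \<comment> \<open>\<open>?f\<close> shifts both positions past \<open>xs\<close>;
    \<open>?g\<close> shifts only the second, for the crossing pairs.\<close>
  have eq: "{(a, b). a < b \<and> b < length (xs @ ys) \<and> (xs @ ys) ! a > (xs @ ys) ! b}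
      = ?A \<union> ?f ` ?B \<union> ?g ` ?C" (is "?L = _")
  proof (intro equalityI subsetI)
    fix p assume "p \<in> ?L"
    then obtain a b where p: "p = (a, b)" and ab: "a < b" "b < length (xs @ ys)"
      "(xs @ ys) ! a > (xs @ ys) ! b" by blast
    consider "b < ?m" | "a < ?m" "?m \<le> b" | "?m \<le> a" by linarith
    then show "p \<in> ?A \<union> ?f ` ?B \<union> ?g ` ?C"
    proof cases
      case 1
      then show ?thesis using p ab by (auto simp: nth_append)
    next
      case 2
      then have "(a, b - ?m) \<in> ?C" using ab by (auto simp: nth_append)
      moreover have "p = ?g (a, b - ?m)" using p 2 by simp
      ultimately show ?thesis by blast
    next
      case 3
      then have "(a - ?m, b - ?m) \<in> ?B" using ab by (auto simp: nth_append)
      moreover have "p = ?f (a - ?m, b - ?m)" using p 3 ab by simp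
      ultimately show ?thesis by blast
    qed
  qed (auto simp: nth_append)
  have fin: "finite ?A" "finite ?B" "finite ?C"
    by (auto intro!: finite_subset[of ?A "{..<length xs} \<times> {..<length xs}"]
        finite_subset[of ?B "{..<length ys} \<times> {..<length ys}"]
        finite_subset[of ?C "{..<length xs} \<times> {..<length ys}"])
  have "bij_betw (map_prod ((!) xs) ((!) ys)) ?C ?D"
    unfolding bij_betw_def
  proof
    show "inj_on (map_prod ((!) xs) ((!) ys)) ?C"
      using assms by (auto simp: inj_on_def nth_eq_iff_index_eq)
    show "map_prod ((!) xs) ((!) ys) ` ?C = ?D"
      by (auto simp: in_set_conv_nth image_iff)
  qed
  then have CD: "card ?C = card ?D" by (rule bij_betw_same_card)
  have inj: "inj_on ?f ?B" "inj_on ?g ?C" by (auto simp: inj_on_def)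
  have "card (?A \<union> ?f ` ?B \<union> ?g ` ?C) = card (?A \<union> ?f ` ?B) + card (?g ` ?C)"
    using fin by (intro card_Un_disjoint) auto
  also have "card (?A \<union> ?f ` ?B) = card ?A + card (?f ` ?B)"
    using fin by (intro card_Un_disjoint) auto
  finally show ?thesis
    unfolding list_inv_def eq card_image[OF inj(1)] card_image[OF inj(2)] CD .
qed

text \<open>The list of a finite set is strictly increasing, so positions and elements correspond in
  an order-preserving way. This replaces positions in a row by columns, the language of the balance
  condition.\<close>

lemma coinv_map_sorted_list_of_set:
  assumes "finite A"
  shows "coinv (map f (sorted_list_of_set A)) =
    card {(a, b). a \<in> A \<and> b \<in> A \<and> a < b \<and> f a < f b}"
proof -
  define s where "s = sorted_list_of_set A"
  have s: "set s = A" "sorted_wrt (<) s" "distinct s"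
    using assms by (auto simp: s_def)
  have mono: "s ! a < s ! b \<longleftrightarrow> a < b" if "a < length s" "b < length s" for a b
    using sorted_wrt_nth_less[OF s(2)] that by (metis linorder_neqE_nat order.asym)
  let ?X = "{(a, b). a < b \<and> b < length (map f s) \<and> map f s ! a < map f s ! b}"
  have "bij_betw (map_prod ((!) s) ((!) s)) ?X
      {(a, b). a \<in> A \<and> b \<in> A \<and> a < b \<and> f a < f b}"
    unfolding bij_betw_def
  proof
    show "inj_on (map_prod ((!) s) ((!) s)) ?X"
      using s(3) by (auto simp: inj_on_def nth_eq_iff_index_eq)
    show "map_prod ((!) s) ((!) s) ` ?X = {(a, b). a \<in> A \<and> b \<in> A \<and> a < b \<and> f a < f b}"
    proof (intro equalityI subsetI)
      fix p assume "p \<in> {(a, b). a \<in> A \<and> b \<in> A \<and> a < b \<and> f a < f b}"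
      then obtain i j where ij: "i < length s" "j < length s" and p: "p = (s ! i, s ! j)"
        and less: "s ! i < s ! j" "f (s ! i) < f (s ! j)"
        unfolding s(1)[symmetric] in_set_conv_nth by blast
      have "(i, j) \<in> ?X"
        using ij less mono[OF ij] by simp
      then show "p \<in> map_prod ((!) s) ((!) s) ` ?X"
        unfolding p by force
    next
      fix p assume "p \<in> map_prod ((!) s) ((!) s) ` ?X"
      then obtain i j where "p = (s ! i, s ! j)" "i < j" "j < length s" "f (s ! i) < f (s ! j)"
        by auto
      then show "p \<in> {(a, b). a \<in> A \<and> b \<in> A \<and> a < b \<and> f a < f b}"
        using mono[of i j] nth_mem[of i s] nth_mem[of j s] s(1) by simp
    qed
  qed
  then show ?thesis
    unfolding coinv_def s_def[symmetric] by (rule bij_betw_same_card)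
qed

text \<open>Induction on the number of rows read. A new row is sorted and adds no inversion of its
  own; its crossing inversions with the word so far are the pairs whose higher cell \<open>x\<close>
  lies in that row.\<close>

lemma list_inv_concat_sorted_rows:
  fixes D :: "(nat \<times> nat) set"
  assumes "finite D" and inj: "inj_on R D"
    and "\<And>r. sorted (rows r)" "\<And>r. distinct (rows r)"
    and set_rows: "\<And>r. set (rows r) = R ` {x \<in> D. fst x = r}"
    and pos: "\<And>x. x \<in> D \<Longrightarrow> 1 \<le> fst x"
  shows "list_inv (concat (map rows [1..<Suc m])) =
    card {(x, y). x \<in> D \<and> y \<in> D \<and> fst x \<le> m \<and> R x < R y \<and> fst x > fst y}"
proof -
  let ?W = "\<lambda>m. concat (map rows [1..<Suc m])"
  let ?P = "\<lambda>m. {(x, y). x \<in> D \<and> y \<in> D \<and> fst x \<le> m \<and> R x < R y \<and> fst x > fst y}"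
  \<comment> \<open>The word starts at row 1; \<open>pos\<close> excludes cells in row 0, which it
    would miss.\<close>
  have set_W: "set (?W m) = R ` {x \<in> D. fst x \<le> m}" for m
    using pos by (fastforce simp: set_rows)
  have dist: "distinct (?W m)" for m
  proof (induction m)
    case (Suc m)
    have "set (?W m) \<inter> set (rows (Suc m)) = {}"
      unfolding set_W set_rows by (subst inj_on_image_Int[OF inj, symmetric]) auto
    with Suc assms(4) show ?case by simp
  qed simp
  have fin: "finite (?P m)" for m
    by (rule finite_subset[of _ "D \<times> D"]) (use assms(1) in auto)
  show ?thesis
  proof (induction m)
    case 0
    have "?P 0 = {}" by auto
    then have "card (?P 0) = 0" by (simp only: card.empty)
    then show ?case by (simp add: list_inv_def)
  next
    case (Suc m)
    let ?U = "{(u, v). u \<in> set (?W m) \<and> v \<in> set (rows (Suc m)) \<and> u > v}"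
    let ?Q = "{(x, y). x \<in> D \<and> y \<in> D \<and> fst x = Suc m \<and> R x < R y \<and> fst x > fst y}"
    \<comment> \<open>The order is swapped: the lower cell \<open>y\<close> is read first and
      carries the larger entry.\<close>
    have "bij_betw (\<lambda>(x, y). (R y, R x)) ?Q ?U"
      unfolding bij_betw_def
    proof
      show "inj_on (\<lambda>(x, y). (R y, R x)) ?Q"
        using inj by (auto simp: inj_on_def)
      show "(\<lambda>(x, y). (R y, R x)) ` ?Q = ?U"
      proof (intro equalityI subsetI)
        fix p assume "p \<in> ?U"
        then obtain x y where p: "p = (R y, R x)" and "x \<in> D" "y \<in> D" "fst y \<le> m"
          "fst x = Suc m" "R x < R y"
          unfolding set_W set_rows by blast
        then have "(x, y) \<in> ?Q" by simp
        then show "p \<in> (\<lambda>(x, y). (R y, R x)) ` ?Q"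
          unfolding p by (rule rev_image_eqI) simp
      next
        fix p assume "p \<in> (\<lambda>(x, y). (R y, R x)) ` ?Q"
        then show "p \<in> ?U"
          unfolding set_W set_rows by (auto intro!: imageI)
      qed
    qed
    then have UQ: "card ?U = card ?Q" by (rule bij_betw_same_card[symmetric])
    have PQ: "?P (Suc m) = ?P m \<union> ?Q" by auto
    have "finite ?Q" using fin[of "Suc m"] unfolding PQ by blast
    then have "card (?P (Suc m)) = card (?P m) + card ?Q"
      unfolding PQ by (intro card_Un_disjoint fin) auto
    moreover have "list_inv (?W (Suc m)) = list_inv (?W m) + card ?U"
      using list_inv_append[OF dist[of m] assms(4)[of "Suc m"]] list_inv_sorted[OF assms(3)]
      by simp
    ultimately show ?case using Suc.IH UQ by simp
  qed
qed

theorem theorem3p19: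
  fixes n :: nat and w :: "nat \<Rightarrow> nat" and R :: "nat \<times> nat \<Rightarrow> nat"
  assumes "w permutes {1..n}"
    and "R \<in> SBT n w"
  shows "int (tableau_inv n w R) =
    int (perm_length (perm_length n w) (tableau_perm n w R))
      - (\<Sum>r = 1..n. int (coinv (tableau_row n w R r)))"
proof -
  define D where "D = rothe n w"
  \<comment> \<open>The decreasing row is a reversed sort and is read from right to left, so the two
    reversals cancel.\<close>
  define rows where "rows = (\<lambda>r. sort (tableau_row n w R r))"
  have R: "bij_betw R D {1..perm_length n w}" and bal: "balanced D R"
    using assms(2) by (auto simp: SBT_def D_def)
  have fin: "finite D" using R bij_betw_finite by blast
  have inj: "inj_on R D" using R by (simp add: bij_betw_def)
  have row_bounds: "1 \<le> fst x \<and> fst x \<le> n" if "x \<in> D" for x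
    using that by (auto simp: D_def rothe_def)
  have fin_row: "finite {c. (r, c) \<in> D}" for r
    by (rule finite_subset[of _ "snd ` D"]) (use fin in force)+
  have fin_col: "finite {i. (i, c) \<in> D}" for c
    by (rule finite_subset[of _ "fst ` D"]) (use fin in force)+
  have row: "tableau_row n w R r = map (\<lambda>c. R (r, c)) (sorted_list_of_set {c. (r, c) \<in> D})" for r
    by (simp add: tableau_row_def D_def)
  have word: "tableau_word n w R = concat (map rows [1..<Suc n])"
    by (simp add: tableau_word_def decreasing_row_def rows_def)
  \<comment> \<open>\<open>perm_length_of_one_line\<close> takes the number of positions to be the
    length of the list, so the word must have \<open>perm_length n w\<close> letters. The number of
    cells is read off from the bijectivity of \<open>R\<close>.\<close>
  have "length (tableau_word n w R) = (\<Sum>r = 1..n. card {c. (r, c) \<in> D})"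
    unfolding word by (simp add: length_concat rows_def row comp_def interv_sum_list_conv_sum_set_nat
        atLeastLessThanSuc_atLeastAtMost del: upt_Suc)
  also have "\<dots> = card (SIGMA r:{1..n}. {c. (r, c) \<in> D})"
    using fin_row by simp
  also have "(SIGMA r:{1..n}. {c. (r, c) \<in> D}) = D"
    using row_bounds by force
  also have "card D = perm_length n w"
    using bij_betw_same_card[OF R] by simp
  finally have len: "length (tableau_word n w R) = perm_length n w" .

  let ?N = "{(x, y). x \<in> D \<and> y \<in> D \<and> R x < R y \<and> fst x > fst y \<and> snd x \<noteq> snd y}"
  let ?S = "{(x, y). x \<in> D \<and> y \<in> D \<and> R x < R y \<and> fst x > fst y \<and> snd x = snd y}"
  have "perm_length (perm_length n w) (tableau_perm n w R) = list_inv (tableau_word n w R)"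
    unfolding tableau_perm_def len[symmetric] by (rule perm_length_of_one_line)
  also have "\<dots> = card {(x, y). x \<in> D \<and> y \<in> D \<and> fst x \<le> n \<and> R x < R y \<and> fst x > fst y}"
    unfolding word
  proof (rule list_inv_concat_sorted_rows[OF fin inj])
    show "distinct (rows r)" for r
      using fin_row inj by (auto simp: rows_def row distinct_map inj_on_def)
    show "set (rows r) = R ` {x \<in> D. fst x = r}" for r
      using fin_row by (force simp: rows_def row)
  qed (use row_bounds in \<open>auto simp: rows_def\<close>)
  also have "{(x, y). x \<in> D \<and> y \<in> D \<and> fst x \<le> n \<and> R x < R y \<and> fst x > fst y} = ?N \<union> ?S"
    using row_bounds by auto
  also have "card (?N \<union> ?S) = card ?N + card ?S"
  proof (rule card_Un_disjoint)
    show "finite ?N" "finite ?S"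
      using fin by (auto intro!: finite_subset[of ?N "D \<times> D"] finite_subset[of ?S "D \<times> D"])
  qed auto
  also have "card ?N = tableau_inv n w R"
    by (simp add: tableau_inv_def D_def)
  finally have main: "perm_length (perm_length n w) (tableau_perm n w R) =
    tableau_inv n w R + card ?S" .

  let ?right = "\<lambda>(i, c). {c'. (i, c') \<in> D \<and> c' > c \<and> R (i, c') > R (i, c)}"
  let ?above = "\<lambda>(i, c). {i'. (i', c) \<in> D \<and> i' > i \<and> R (i', c) < R (i, c)}"
  \<comment> \<open>Each same-column pair is indexed by its lower cell \<open>y\<close>, which has
    the larger entry; the upper cell is then determined by its row \<open>i'\<close>.\<close>
  have "bij_betw (\<lambda>(y, i'). ((i', snd y), y)) (SIGMA y:D. ?above y) ?S"
    by (rule bij_betw_byWitness[where f' = "\<lambda>(x, y). (y, fst x)"]) auto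
  then have "card ?S = card (SIGMA y:D. ?above y)"
    by (rule bij_betw_same_card[symmetric])
  also have "\<dots> = (\<Sum>y\<in>D. card (?above y))"
  proof (intro card_SigmaI ballI fin)
    show "finite (?above y)" for y
      by (rule finite_subset[OF _ fin_col[of "snd y"]]) (auto split: prod.split)
  qed
  \<comment> \<open>The balance condition enters here, once for each cell.\<close>
  also have "\<dots> = (\<Sum>y\<in>D. card (?right y))"
    using bal by (intro sum.cong) (auto simp: balanced_def)
  also have "\<dots> = card (SIGMA y:D. ?right y)"
  proof (intro card_SigmaI[symmetric] ballI fin)
    show "finite (?right y)" for y
      by (rule finite_subset[OF _ fin_row[of "fst y"]]) (auto split: prod.split)
  qed
  \<comment> \<open>Regrouping by row: a cell with a larger entry to its right is a coinversion of
    the row containing both.\<close>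
  also have "\<dots> = card (SIGMA r:{1..n}. {(c, c'). c \<in> {c. (r, c) \<in> D} \<and> c' \<in> {c. (r, c) \<in> D}
      \<and> c < c' \<and> R (r, c) < R (r, c')})" (is "_ = card (Sigma _ ?co)")
    by (rule bij_betw_same_card[of "\<lambda>((r, c), c'). (r, (c, c'))"],
        rule bij_betw_byWitness[where f' = "\<lambda>(r, (c, c')). ((r, c), c')"])
      (use row_bounds in force)+
  also have "\<dots> = (\<Sum>r = 1..n. card (?co r))"
  proof (intro card_SigmaI ballI)
    show "finite (?co r)" for r
      by (rule finite_subset[of _ "{c. (r, c) \<in> D} \<times> {c. (r, c) \<in> D}"]) (use fin_row in auto)
  qed simp
  also have "\<dots> = (\<Sum>r = 1..n. coinv (tableau_row n w R r))"
    unfolding row coinv_map_sorted_list_of_set[OF fin_row] ..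
  finally show ?thesis using main by simp
qed

end
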